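(* Let $X$ and $X'$ be two non-empty metric spaces. Then $\dim_{\rm N}(X \times X') \le \dim_{\rm N} X + \dim_{\rm N} X'$.
   Context: A family $(B_i)_{i\in I}$ of subsets of a metric space $X=(X,d)$ is called $D$-bounded ($D \ge 0$) if $\operatorname{diam} B_i := \sup\{d(x,x') : x,x'\in B_i\} \le D$ for all $i$. For $s>0$, the $s$-multiplicity of the family is the infimum of all integers $n \ge 0$ such that every subset of $X$ with diameter $\le s$ meets at most $n$ members of the family. The Nagata dimension $\dim_{\rm N} X$ of a metric space $X$ is the infimum of all integers $n$ with the following property: there exists a constant $c>0$ such that for all $s>0$, $X$ has a $cs$-bounded covering with $s$-multiplicity at most $n+1$ (the value is $\infty$ if there is no such $n$). The product $X \times X'$ carries the $\ell^2$ product metric $d((x,x'),(y,y')) = (d(x,y)^2 + d(x',y')^2)^{1/2}$. *)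

theory Defs
  imports "HOL-Analysis.Analysis"
begin

text \<open>
  Metric spaces are values of the library type of abstract metric spaces, which have an arbitrary
  (possibly empty) carrier \<open>mspace X\<close>. Diameters, multiplicities and dimensions take extended real
  values. The supremum over the empty set is \<open>-\<infinity>\<close> in this type, so the empty set has diameter
  at most \<open>s\<close> for every real \<open>s\<close>.
\<close>

definition diam :: "'a metric \<Rightarrow> 'a set \<Rightarrow> ereal" where
  "diam X A = (SUP (x, x') \<in> A \<times> A. ereal (mdist X x x'))"

definition bounded_family :: "'a metric \<Rightarrow> real \<Rightarrow> 'i set \<Rightarrow> ('i \<Rightarrow> 'a set) \<Rightarrow> bool" where
  "bounded_family X D I B \<longleftrightarrow> (\<forall>i\<in>I. diam X (B i) \<le> ereal D)"

definition covering_family :: "'a metric \<Rightarrow> 'i set \<Rightarrow> ('i \<Rightarrow> 'a set) \<Rightarrow> bool" where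
  "covering_family X I B \<longleftrightarrow> (\<Union>i\<in>I. B i) = mspace X"

text \<open>Members are counted by index. The value is \<open>\<infinity>\<close> if no integer qualifies.\<close>

definition s_multiplicity :: "'a metric \<Rightarrow> real \<Rightarrow> 'i set \<Rightarrow> ('i \<Rightarrow> 'a set) \<Rightarrow> ereal" where
  "s_multiplicity X s I B =
    Inf {ereal (real n) | n :: nat.
      \<forall>A \<subseteq> mspace X. diam X A \<le> ereal s \<longrightarrow>
        finite {i \<in> I. A \<inter> B i \<noteq> {}} \<and> card {i \<in> I. A \<inter> B i \<noteq> {}} \<le> n}"

text \<open>
  HOL cannot quantify over the type of indices inside a formula, so the coverings below are indexed
  by sets of subsets of the space. This is no restriction: see \<open>nagata_property_any_index\<close>.
\<close>

definition nagata_property :: "'a metric \<Rightarrow> int \<Rightarrow> bool" where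
  "nagata_property X n \<longleftrightarrow>
    (\<exists>c::real. c > 0 \<and> (\<forall>s::real. s > 0 \<longrightarrow>
      (\<exists>(I :: 'a set set) (B :: 'a set \<Rightarrow> 'a set).
        covering_family X I B \<and> bounded_family X (c * s) I B \<and>
        s_multiplicity X s I B \<le> ereal (real_of_int (n + 1)))))"

text \<open>
  The infimum ranges over all integers, so the empty space has dimension \<open>-1\<close>; the infimum of the
  empty set is \<open>\<infinity>\<close>.
\<close>

definition nagata_dim :: "'a metric \<Rightarrow> ereal" where
  "nagata_dim X = Inf {ereal (real_of_int n) | n :: int. nagata_property X n}"

lemma s_multiplicity_image_le:
  "s_multiplicity X s (B ` I) (\<lambda>S. S) \<le> s_multiplicity X s I B"
proof -
  have *: "finite {S \<in> B ` I. A \<inter> S \<noteq> {}} \<and> card {S \<in> B ` I. A \<inter> S \<noteq> {}} \<le> n"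
    if "finite {i \<in> I. A \<inter> B i \<noteq> {}} \<and> card {i \<in> I. A \<inter> B i \<noteq> {}} \<le> n" for A n
  proof -
    have eq: "{S \<in> B ` I. A \<inter> S \<noteq> {}} = B ` {i \<in> I. A \<inter> B i \<noteq> {}}"
      by blast
    show ?thesis
      unfolding eq using that card_image_le[of "{i \<in> I. A \<inter> B i \<noteq> {}}" B]
      by (intro conjI finite_imageI) linarith+
  qed
  show ?thesis
    unfolding s_multiplicity_def
  proof (rule Inf_superset_mono, rule subsetI, elim CollectE exE conjE)
    fix x n
    assume x: "x = ereal (real n)"
      and n: "\<forall>A \<subseteq> mspace X. diam X A \<le> ereal s \<longrightarrow>
        finite {i \<in> I. A \<inter> B i \<noteq> {}} \<and> card {i \<in> I. A \<inter> B i \<noteq> {}} \<le> n"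
    have "\<forall>A \<subseteq> mspace X. diam X A \<le> ereal s \<longrightarrow>
        finite {S \<in> B ` I. A \<inter> S \<noteq> {}} \<and> card {S \<in> B ` I. A \<inter> S \<noteq> {}} \<le> n"
      by (intro allI impI *) (rule n[rule_format])
    then show "x \<in> {ereal (real n) | n :: nat.
      \<forall>A \<subseteq> mspace X. diam X A \<le> ereal s \<longrightarrow>
        finite {S \<in> B ` I. A \<inter> S \<noteq> {}} \<and> card {S \<in> B ` I. A \<inter> S \<noteq> {}} \<le> n}"
      unfolding x by blast
  qed
qed

lemma nagata_property_any_index:
  fixes X :: "'a metric" and c :: real
    and I :: "real \<Rightarrow> 'i set" and B :: "real \<Rightarrow> 'i \<Rightarrow> 'a set"
  assumes "c > 0"
    and "\<And>s. s > 0 \<Longrightarrow> covering_family X (I s) (B s)"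
    and "\<And>s. s > 0 \<Longrightarrow> bounded_family X (c * s) (I s) (B s)"
    and "\<And>s. s > 0 \<Longrightarrow> s_multiplicity X s (I s) (B s) \<le> ereal (real_of_int (n + 1))"
  shows "nagata_property X n"
  unfolding nagata_property_def
proof (intro exI conjI allI impI)
  fix s :: real
  assume s: "s > 0"
  show "covering_family X (B s ` I s) (\<lambda>S. S)"
    using assms(2)[OF s] by (simp add: covering_family_def)
  show "bounded_family X (c * s) (B s ` I s) (\<lambda>S. S)"
    using assms(3)[OF s] by (simp add: bounded_family_def)
  show "s_multiplicity X s (B s ` I s) (\<lambda>S. S) \<le> ereal (real_of_int (n + 1))"
    using s_multiplicity_image_le assms(4)[OF s] by (rule order_trans)
qed (fact assms(1))

end

theory Submission
  imports Defs
begin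

text \<open>
  The idea is to cover both factors by coloured families that are highly redundant, and to multiply
  them colour by colour.

  Let \<open>X\<close> have a covering by sets of controlled diameter such that the ball of radius \<open>k s\<close> around
  any point meets at most \<open>n + 1\<close> members. Record at each point \<open>x\<close> the set \<open>N\<^sub>j x\<close> of members that
  contain a point at distance at most \<open>j s\<close> from \<open>x\<close>, for \<open>j = 0, \<dots>, k\<close>. These sets increase with \<open>j\<close>, they are
  non-empty, and the last one has at most \<open>n + 1\<close> elements; so \<open>N\<^sub>j x \<noteq> N\<^sub>j\<^sub>+\<^sub>1 x\<close> for at most \<open>n\<close>
  values of \<open>j < k\<close>. Let the colour class \<open>T\<^sub>j\<close> be the set of points with \<open>N\<^sub>j x = N\<^sub>j\<^sub>+\<^sub>1 x\<close>. Every
  point then lies in at least \<open>k - n\<close> of the \<open>k\<close> classes. If \<open>x\<close> and \<open>y\<close> in \<open>T\<^sub>j\<close> are at distance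
  at most \<open>s\<close>, then \<open>N\<^sub>j x \<subseteq> N\<^sub>j\<^sub>+\<^sub>1 y = N\<^sub>j y\<close> and vice versa, so the label \<open>N\<^sub>j\<close> cuts \<open>T\<^sub>j\<close> into
  pieces that are more than \<open>s\<close> apart. Points with the same label are close to a common member,
  so the pieces are bounded by a multiple of \<open>s\<close>. This is \<open>redundant_colouring_exists\<close>.

  Now let \<open>X\<close> and \<open>X'\<close> have such colourings with \<open>k = n + m + 1\<close> colours each. A point \<open>x\<close> carries
  at least \<open>m + 1\<close> colours and a point \<open>x'\<close> at least \<open>n + 1\<close>, which is \<open>k + 1\<close> in total, so they
  share a colour. Hence the products of pieces of equal colour cover \<open>X \<times> X'\<close>. A set of diameter at
  most \<open>s\<close> meets at most one such product for each colour, hence at most \<open>n + m + 1\<close> altogether;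
  this is \<open>nagata_property_prod\<close>. The same idea, with many redundant colours, is behind the
  Kolmogorov--Ostrand argument in dimension theory.
\<close>

section \<open>Diameter and multiplicity in elementary terms\<close>

lemma mdist_self: "x \<in> mspace X \<Longrightarrow> mdist X x x = 0"
  by simp

lemma diam_le_iff: "diam X A \<le> ereal s \<longleftrightarrow> (\<forall>x\<in>A. \<forall>y\<in>A. mdist X x y \<le> s)"
  by (auto simp: diam_def SUP_le_iff)

text \<open>An infimum of natural numbers is attained if it is finite, so that the bound \<open>n\<close> itself qualifies.\<close>

lemma s_multiplicity_le_iff:
  "s_multiplicity X s I B \<le> ereal (real n) \<longleftrightarrow>
    (\<forall>A \<subseteq> mspace X. diam X A \<le> ereal s \<longrightarrow>
      finite {i \<in> I. A \<inter> B i \<noteq> {}} \<and> card {i \<in> I. A \<inter> B i \<noteq> {}} \<le> n)"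
  (is "_ \<longleftrightarrow> ?P n")
proof
  assume "s_multiplicity X s I B \<le> ereal (real n)"
  then have "Inf {ereal (real p) | p. ?P p} < ereal (real (Suc n))"
    unfolding s_multiplicity_def by (rule order_le_less_trans) simp
  then obtain e where "e \<in> {ereal (real p) | p. ?P p}" and "e < ereal (real (Suc n))"
    unfolding Inf_less_iff by blast
  then obtain p where p: "?P p" and "ereal (real p) < ereal (real (Suc n))"
    by blast
  from this(2) have "p \<le> n"
    by simp
  show "?P n"
  proof (intro allI impI)
    fix A
    assume "A \<subseteq> mspace X" and "diam X A \<le> ereal s"
    then have "finite {i \<in> I. A \<inter> B i \<noteq> {}} \<and> card {i \<in> I. A \<inter> B i \<noteq> {}} \<le> p"
      using p by blast
    then show "finite {i \<in> I. A \<inter> B i \<noteq> {}} \<and> card {i \<in> I. A \<inter> B i \<noteq> {}} \<le> n"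
      using \<open>p \<le> n\<close> by simp
  qed
next
  assume "?P n"
  then show "s_multiplicity X s I B \<le> ereal (real n)"
    unfolding s_multiplicity_def by (intro Inf_lower) blast
qed

text \<open>A single point is a set of diameter \<open>0\<close>, and it meets some member of every covering.\<close>

lemma nagata_property_nonneg:
  fixes X :: "'a metric"
  assumes "nagata_property X n" and "mspace X \<noteq> {}"
  shows "0 \<le> n"
proof (rule ccontr)
  assume "\<not> 0 \<le> n"
  then have n: "ereal (real_of_int (n + 1)) \<le> ereal (real 0)"
    by simp
  obtain x where x: "x \<in> mspace X"
    using assms(2) by blast
  obtain c :: real where "\<forall>s>0. \<exists>(I :: 'a set set) (B :: 'a set \<Rightarrow> 'a set).
      covering_family X I B \<and> bounded_family X (c * s) I B \<and>
      s_multiplicity X s I B \<le> ereal (real_of_int (n + 1))"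
    using assms(1) unfolding nagata_property_def by blast
  from this[rule_format, OF zero_less_one]
  obtain I and B :: "'a set \<Rightarrow> 'a set" where cov: "covering_family X I B"
    and "s_multiplicity X 1 I B \<le> ereal (real_of_int (n + 1))"
    by blast
  from this(2) n have "s_multiplicity X 1 I B \<le> ereal (real 0)"
    by (rule order_trans)
  note this[unfolded s_multiplicity_le_iff, rule_format, of "{x}"]
  moreover have "{x} \<subseteq> mspace X" and "diam X {x} \<le> ereal 1"
    using x by (simp_all add: diam_le_iff mdist_self)
  ultimately have "finite {i \<in> I. {x} \<inter> B i \<noteq> {}} \<and> card {i \<in> I. {x} \<inter> B i \<noteq> {}} \<le> 0"
    by blast
  then have "{i \<in> I. {x} \<inter> B i \<noteq> {}} = {}"
    by (metis card_0_eq le_zero_eq)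
  moreover have "x \<in> (\<Union>i\<in>I. B i)"
    using cov x by (simp add: covering_family_def)
  ultimately show False
    by auto
qed

section \<open>Redundant colourings of a single space\<close>

text \<open>
  The pieces of colour \<open>j\<close> are the fibres of the label \<open>l j\<close> on \<open>T j\<close>. The separation condition says
  that close points of \<open>T j\<close> lie in the same piece. The redundancy condition, that every point has at
  least \<open>k - n\<close> of the \<open>k\<close> colours, is stated additively because subtraction truncates.
\<close>

definition redundant_colouring ::
    "'a metric \<Rightarrow> nat \<Rightarrow> nat \<Rightarrow> real \<Rightarrow> real \<Rightarrow> (nat \<Rightarrow> 'a set) \<Rightarrow> (nat \<Rightarrow> 'a \<Rightarrow> 'l) \<Rightarrow> bool" where
  "redundant_colouring X n k s D T l \<longleftrightarrow>
    (\<forall>j<k. T j \<subseteq> mspace X) \<and>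
    (\<forall>j<k. \<forall>x\<in>T j. \<forall>y\<in>T j. mdist X x y \<le> s \<longrightarrow> l j x = l j y) \<and>
    (\<forall>j<k. \<forall>x\<in>T j. \<forall>y\<in>T j. l j x = l j y \<longrightarrow> mdist X x y \<le> D) \<and>
    (\<forall>x\<in>mspace X. k \<le> n + card {j. j < k \<and> x \<in> T j})"

text \<open>Each strict step of an increasing chain of finite sets adds an element.\<close>

lemma card_strict_steps_le:
  assumes "\<And>j. N j \<subseteq> N (Suc j)" and "\<And>j. j \<le> k \<Longrightarrow> finite (N j)"
  shows "card {j. j < k \<and> N j \<noteq> N (Suc j)} + card (N 0) \<le> card (N k)"
  using assms(2)
proof (induction k)
  case (Suc k)
  have IH: "card {j. j < k \<and> N j \<noteq> N (Suc j)} + card (N 0) \<le> card (N k)"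
    using Suc by simp
  show ?case
  proof (cases "N k = N (Suc k)")
    case True
    then have "{j. j < Suc k \<and> N j \<noteq> N (Suc j)} = {j. j < k \<and> N j \<noteq> N (Suc j)}"
      by (auto simp: less_Suc_eq)
    then show ?thesis
      using IH True by simp
  next
    case False
    then have "{j. j < Suc k \<and> N j \<noteq> N (Suc j)} = insert k {j. j < k \<and> N j \<noteq> N (Suc j)}"
      by (auto simp: less_Suc_eq)
    moreover have "card (N k) < card (N (Suc k))"
      using False assms(1)[of k] Suc.prems[of "Suc k"] by (intro psubset_card_mono) auto
    ultimately show ?thesis
      using IH by simp
  qed
qed simp

text \<open>The covering is taken at the scale \<open>2 k s\<close>, so that the ball of radius \<open>k s\<close>, the largest that
  the labels look at, is a set to which the multiplicity bound applies.\<close>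

lemma redundant_colouring_of_covering:
  fixes X :: "'a metric" and B :: "'i \<Rightarrow> 'a set"
  assumes cov: "covering_family X I B" and bdd: "bounded_family X D I B"
    and mult: "s_multiplicity X (2 * real k * s) I B \<le> ereal (real (Suc n))"
    and s: "s > 0"
  shows "\<exists>T (l :: nat \<Rightarrow> 'a \<Rightarrow> 'i set). redundant_colouring X n k s (D + 2 * real k * s) T l"
proof -
  define N where "N j x = {i \<in> I. \<exists>b\<in>B i. mdist X x b \<le> real j * s}" for j x
  define T where "T j = {x \<in> mspace X. N j x = N (Suc j) x}" for j
  have B_sub: "b \<in> mspace X" if "b \<in> B i" "i \<in> I" for b i
    using cov that by (auto simp: covering_family_def)
  have N_mono: "N j x \<subseteq> N (Suc j) x" for j x
  proof -
    have "real j * s \<le> real (Suc j) * s"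
      using s by (simp add: mult_right_mono)
    then show ?thesis
      unfolding N_def by (blast intro: order_trans)
  qed
  have N_shift: "N j x \<subseteq> N (Suc j) y"
    if "x \<in> mspace X" "y \<in> mspace X" "mdist X x y \<le> s" for j x y
  proof
    fix i
    assume "i \<in> N j x"
    then obtain b where i: "i \<in> I" and b: "b \<in> B i" "mdist X x b \<le> real j * s"
      by (auto simp: N_def)
    have "mdist X y b \<le> mdist X y x + mdist X x b"
      using that B_sub[OF b(1) i] by (simp add: mdist_triangle)
    also have "\<dots> \<le> real (Suc j) * s"
      using that(3) b(2) by (simp add: mdist_commute algebra_simps)
    finally show "i \<in> N (Suc j) y"
      using i b(1) by (auto simp: N_def)
  qed
  have N_nonempty: "N j x \<noteq> {}" if "x \<in> mspace X" for j x
  proof -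
    obtain i where "i \<in> I" "x \<in> B i"
      using cov \<open>x \<in> mspace X\<close> by (auto simp: covering_family_def)
    moreover have "mdist X x x \<le> real j * s"
      using s \<open>x \<in> mspace X\<close> by (simp add: mdist_self)
    ultimately have "i \<in> N j x"
      by (auto simp: N_def)
    then show ?thesis
      by blast
  qed
  have N_card: "finite (N j x) \<and> card (N j x) \<le> Suc n" if "x \<in> mspace X" "j \<le> k" for j x
  proof -
    define A where "A = {y \<in> mspace X. mdist X x y \<le> real j * s}"
    have "mdist X y z \<le> 2 * real k * s" if "y \<in> A" "z \<in> A" for y z
    proof -
      have "mdist X y z \<le> mdist X y x + mdist X x z"
        using that \<open>x \<in> mspace X\<close> by (auto simp: A_def intro: mdist_triangle)
      also have "\<dots> \<le> 2 * (real j * s)"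
        using that by (simp add: A_def mdist_commute)
      also have "\<dots> \<le> 2 * (real k * s)"
        using s \<open>j \<le> k\<close> by (simp add: mult_right_mono)
      finally show ?thesis
        by simp
    qed
    then have "diam X A \<le> ereal (2 * real k * s)"
      by (simp add: diam_le_iff)
    moreover have "A \<subseteq> mspace X"
      by (auto simp: A_def)
    moreover have "N j x = {i \<in> I. A \<inter> B i \<noteq> {}}"
      using B_sub by (auto simp: N_def A_def)
    ultimately show ?thesis
      using mult by (simp add: s_multiplicity_le_iff del: of_nat_Suc)
  qed
  have sep: "N j x = N j y" if "x \<in> T j" "y \<in> T j" "mdist X x y \<le> s" for j x y
  proof (rule equalityI)
    have xy: "x \<in> mspace X" "y \<in> mspace X" "N (Suc j) x = N j x" "N (Suc j) y = N j y"
      using that(1,2) by (simp_all add: T_def)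
    show "N j x \<subseteq> N j y"
      using N_shift[OF xy(1,2) that(3), of j] unfolding xy(4) .
    have "mdist X y x \<le> s"
      using that(3) by (subst mdist_commute)
    then show "N j y \<subseteq> N j x"
      using N_shift[OF xy(2,1), of j] unfolding xy(3) by blast
  qed
  have bdd: "mdist X x y \<le> D + 2 * real k * s"
    if x: "x \<in> mspace X" and y: "y \<in> mspace X" and "j < k" and eq: "N j x = N j y" for j x y
  proof -
    obtain i where "i \<in> N j x" "i \<in> N j y"
      using N_nonempty[OF x, of j] unfolding eq by blast
    then obtain b c where i: "i \<in> I" and b: "b \<in> B i" "mdist X x b \<le> real j * s"
      and c: "c \<in> B i" "mdist X y c \<le> real j * s"
      by (auto simp: N_def)
    note bc = B_sub[OF b(1) i] B_sub[OF c(1) i]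
    have "mdist X b c \<le> D"
      using bdd i b c by (auto simp: bounded_family_def diam_le_iff)
    moreover have "mdist X x y \<le> mdist X x b + mdist X b y"
      using x y bc by (intro mdist_triangle)
    moreover have "mdist X b y \<le> mdist X b c + mdist X c y"
      using x y bc by (intro mdist_triangle)
    moreover have "real j * s \<le> real k * s"
      using s \<open>j < k\<close> by (simp add: mult_right_mono)
    ultimately show ?thesis
      using b(2) c(2) mdist_commute[of X c y] by linarith
  qed
  have red: "k \<le> n + card {j. j < k \<and> x \<in> T j}" if x: "x \<in> mspace X" for x
  proof -
    have "card {j. j < k \<and> N j x \<noteq> N (Suc j) x} + card (N 0 x) \<le> card (N k x)"
      using N_card[OF x] N_mono by (intro card_strict_steps_le) auto
    moreover have "card (N 0 x) > 0"
      using N_nonempty[OF x, of 0] N_card[OF x, of 0] by (simp add: card_gt_0_iff)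
    ultimately have "card {j. j < k \<and> N j x \<noteq> N (Suc j) x} \<le> n"
      using N_card[OF x, of k] by simp
    moreover have "card {j. j < k \<and> N j x \<noteq> N (Suc j) x} + card {j. j < k \<and> x \<in> T j}
        = card ({j. j < k \<and> N j x \<noteq> N (Suc j) x} \<union> {j. j < k \<and> x \<in> T j})"
      by (rule card_Un_disjoint[symmetric]) (auto simp: T_def)
    moreover have "{j. j < k \<and> N j x \<noteq> N (Suc j) x} \<union> {j. j < k \<and> x \<in> T j} = {..<k}"
      using x by (auto simp: T_def)
    ultimately show ?thesis
      by simp
  qed
  have T_sub: "T j \<subseteq> mspace X" for j
    by (auto simp: T_def)
  have "redundant_colouring X n k s (D + 2 * real k * s) T N"
    unfolding redundant_colouring_def
    using T_sub sep bdd[OF subsetD[OF T_sub] subsetD[OF T_sub]] red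
    by (intro conjI allI impI ballI)
  then show ?thesis
    by blast
qed

text \<open>The number of colours \<open>k\<close> is fixed before the constant \<open>c\<close>, which grows with \<open>k\<close>. This does no
  harm, because \<open>k\<close> will depend on the two dimensions only.\<close>

lemma redundant_colouring_exists:
  fixes X :: "'a metric"
  assumes "nagata_property X (int n)" and "k > 0"
  obtains c where "c > 0"
    and "\<forall>s>0. \<exists>T (l :: nat \<Rightarrow> 'a \<Rightarrow> 'a set set). redundant_colouring X n k s (c * s) T l"
proof -
  obtain c where c: "c > 0" and cov: "\<And>s. s > 0 \<Longrightarrow>
      \<exists>(I :: 'a set set) (B :: 'a set \<Rightarrow> 'a set). covering_family X I B \<and>
        bounded_family X (c * s) I B \<and> s_multiplicity X s I B \<le> ereal (real (Suc n))"
    using assms(1) unfolding nagata_property_def by (auto simp: add.commute)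
  show thesis
  proof (rule that; (intro allI impI)?)
    show "2 * real k * (c + 1) > 0"
      using c \<open>k > 0\<close> by simp
    fix s :: real
    assume s: "s > 0"
    then have "2 * real k * s > 0"
      using \<open>k > 0\<close> by simp
    then obtain I and B :: "'a set \<Rightarrow> 'a set" where *: "covering_family X I B"
      "bounded_family X (c * (2 * real k * s)) I B"
      "s_multiplicity X (2 * real k * s) I B \<le> ereal (real (Suc n))"
      using cov by blast
    have "c * (2 * real k * s) + 2 * real k * s = 2 * real k * (c + 1) * s"
      by (simp add: algebra_simps)
    then show "\<exists>T (l :: nat \<Rightarrow> 'a \<Rightarrow> 'a set set).
        redundant_colouring X n k s (2 * real k * (c + 1) * s) T l"
      using redundant_colouring_of_covering[OF * s] by simp
  qed
qed

section \<open>The product\<close>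

lemma mdist_prod_metric_eq:
  "mdist (prod_metric X X') (x, x') (y, y') = sqrt ((mdist X x y)\<^sup>2 + (mdist X' x' y')\<^sup>2)"
  by (simp add: prod_dist_def)

lemma mdist_fst_le_prod: "mdist X x y \<le> mdist (prod_metric X X') (x, x') (y, y')"
  unfolding mdist_prod_metric_eq by (rule real_le_rsqrt) simp

lemma mdist_snd_le_prod: "mdist X' x' y' \<le> mdist (prod_metric X X') (x, x') (y, y')"
  unfolding mdist_prod_metric_eq by (rule real_le_rsqrt) simp

lemma mdist_prod_le_add:
  "mdist (prod_metric X X') (x, x') (y, y') \<le> mdist X x y + mdist X' x' y'"
  unfolding mdist_prod_metric_eq by (rule sqrt_sum_squares_le_sum) simp_all

text \<open>The bound on the redundancies, here in the form \<open>n + m < k\<close>, forces a point of \<open>X\<close>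
  and a point of \<open>X'\<close> to share a colour.\<close>

lemma common_colour:
  assumes "redundant_colouring X n k s D T l" and "redundant_colouring X' m k s' D' T' l'"
    and "n + m < k" and "x \<in> mspace X" and "x' \<in> mspace X'"
  obtains j where "j < k" and "x \<in> T j" and "x' \<in> T' j"
proof (rule ccontr)
  let ?J = "{j. j < k \<and> x \<in> T j}" and ?J' = "{j. j < k \<and> x' \<in> T' j}"
  assume "\<not> thesis"
  then have "?J \<inter> ?J' = {}"
    using that by blast
  then have "card ?J + card ?J' = card (?J \<union> ?J')"
    by (intro card_Un_disjoint[symmetric]) auto
  also have "\<dots> \<le> card {..<k}"
    by (intro card_mono) auto
  finally have "card ?J + card ?J' \<le> k"
    by simp
  moreover have "k \<le> n + card ?J" and "k \<le> m + card ?J'"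
    using assms by (auto simp: redundant_colouring_def)
  ultimately show False
    using assms(3) by linarith
qed

text \<open>Two points of \<open>X \<times> X'\<close> at distance at most \<open>s\<close> have both pairs of coordinates at distance at most
  \<open>s\<close>. So if their coordinates have the same colour, then their labels agree as well, and there is
  at most one member per colour near any point.\<close>

lemma covering_of_redundant_colourings:
  fixes X :: "'a metric" and X' :: "'b metric"
    and l :: "nat \<Rightarrow> 'a \<Rightarrow> 'l" and l' :: "nat \<Rightarrow> 'b \<Rightarrow> 'm"
  assumes col: "redundant_colouring X n k s D T l"
    and col': "redundant_colouring X' m k s D' T' l'"
    and k: "n + m < k"
  defines "I \<equiv> {..<k} \<times> (UNIV :: ('l \<times> 'm) set)"
    and "B \<equiv> \<lambda>(j, a, a'). {x \<in> T j. l j x = a} \<times> {x' \<in> T' j. l' j x' = a'}"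
  shows "covering_family (prod_metric X X') I B"
    and "bounded_family (prod_metric X X') (D + D') I B"
    and "s_multiplicity (prod_metric X X') s I B \<le> ereal (real k)"
proof -
  have T: "T j \<subseteq> mspace X" "T' j \<subseteq> mspace X'" if "j < k" for j
    using col col' that by (auto simp: redundant_colouring_def)
  have sep: "l j x = l j y" if "j < k" "x \<in> T j" "y \<in> T j" "mdist X x y \<le> s" for j x y
    using col that unfolding redundant_colouring_def by blast
  have sep': "l' j x = l' j y" if "j < k" "x \<in> T' j" "y \<in> T' j" "mdist X' x y \<le> s" for j x y
    using col' that unfolding redundant_colouring_def by blast
  have bdd: "mdist X x y \<le> D" if "j < k" "x \<in> T j" "y \<in> T j" "l j x = l j y" for j x y
    using col that unfolding redundant_colouring_def by blast
  have bdd': "mdist X' x y \<le> D'" if "j < k" "x \<in> T' j" "y \<in> T' j" "l' j x = l' j y" for j x y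
    using col' that unfolding redundant_colouring_def by blast
  show "covering_family (prod_metric X X') I B"
    unfolding covering_family_def
  proof (rule equalityI; rule subsetI)
    fix z
    assume "z \<in> (\<Union>i\<in>I. B i)"
    then show "z \<in> mspace (prod_metric X X')"
      using T by (auto simp: I_def B_def)
  next
    fix z
    assume "z \<in> mspace (prod_metric X X')"
    then obtain x x' where z: "z = (x, x')" "x \<in> mspace X" "x' \<in> mspace X'"
      by auto
    obtain j where "j < k" "x \<in> T j" "x' \<in> T' j"
      using common_colour[OF col col' k z(2,3)] .
    then have "(j, l j x, l' j x') \<in> I" "z \<in> B (j, l j x, l' j x')"
      using z by (auto simp: I_def B_def)
    then show "z \<in> (\<Union>i\<in>I. B i)"
      by blast
  qed
  show "bounded_family (prod_metric X X') (D + D') I B"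
    unfolding bounded_family_def diam_le_iff
  proof (intro ballI)
    fix i z w
    assume "i \<in> I" "z \<in> B i" "w \<in> B i"
    then obtain j x x' y y' where zw: "z = (x, x')" "w = (y, y')" and j: "j < k"
      and x: "x \<in> T j" "y \<in> T j" "l j x = l j y"
      and x': "x' \<in> T' j" "y' \<in> T' j" "l' j x' = l' j y'"
      by (auto simp: I_def B_def)
    show "mdist (prod_metric X X') z w \<le> D + D'"
      unfolding zw using mdist_prod_le_add[of X X' x x' y y'] bdd[OF j x] bdd'[OF j x']
      by linarith
  qed
  show "s_multiplicity (prod_metric X X') s I B \<le> ereal (real k)"
    unfolding s_multiplicity_le_iff
  proof (intro allI impI)
    fix A
    assume "diam (prod_metric X X') A \<le> ereal s"
    then have A: "mdist (prod_metric X X') z w \<le> s" if "z \<in> A" "w \<in> A" for z w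
      using that by (simp add: diam_le_iff)
    let ?M = "{i \<in> I. A \<inter> B i \<noteq> {}}"
    \<comment> \<open>By separation, a member that meets \<open>A\<close> is determined by its colour.\<close>
    have "inj_on fst ?M"
    proof (rule inj_onI)
      fix p q
      assume p: "p \<in> ?M" and q: "q \<in> ?M" and pq: "fst p = fst q"
      obtain j x x' where x: "p = (j, l j x, l' j x')" "j < k" "x \<in> T j" "x' \<in> T' j" "(x, x') \<in> A"
        using p by (auto simp: I_def B_def)
      obtain i y y' where y0: "q = (i, l i y, l' i y')" "y \<in> T i" "y' \<in> T' i" "(y, y') \<in> A"
        using q by (auto simp: I_def B_def)
      have "i = j"
        using pq x(1) y0(1) by simp
      note y = y0[unfolded this]
      have near: "mdist X x y \<le> s" "mdist X' x' y' \<le> s"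
        using A[OF x(5) y(4)] mdist_fst_le_prod[of X x y X' x' y']
          mdist_snd_le_prod[of X' x' y' X x y] by linarith+
      show "p = q"
        unfolding x(1) y(1) using sep[OF x(2,3) y(2) near(1)] sep'[OF x(2,4) y(3) near(2)] by simp
    qed
    moreover have "fst ` ?M \<subseteq> {..<k}"
      by (auto simp: I_def)
    ultimately show "finite ?M \<and> card ?M \<le> k"
      using inj_on_finite[of fst ?M "{..<k}"] card_inj_on_le[of fst ?M "{..<k}"] by simp
  qed
qed

lemma nagata_property_prod:
  fixes X :: "'a metric" and X' :: "'b metric"
  assumes "nagata_property X (int n)" and "nagata_property X' (int m)"
  shows "nagata_property (prod_metric X X') (int (n + m))"
proof -
  define k where "k = Suc (n + m)"
  have k: "k > 0" "n + m < k"
    by (simp_all add: k_def)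
  obtain c where c: "c > 0" and "\<forall>s>0.
      \<exists>T (l :: nat \<Rightarrow> 'a \<Rightarrow> 'a set set). redundant_colouring X n k s (c * s) T l"
    using redundant_colouring_exists[OF assms(1) k(1)] .
  from this(2)[unfolded choice_iff'] obtain T and l :: "real \<Rightarrow> nat \<Rightarrow> 'a \<Rightarrow> 'a set set"
    where col: "\<And>s. s > 0 \<Longrightarrow> redundant_colouring X n k s (c * s) (T s) (l s)"
    by blast
  obtain c' where c': "c' > 0" and "\<forall>s>0.
      \<exists>T (l :: nat \<Rightarrow> 'b \<Rightarrow> 'b set set). redundant_colouring X' m k s (c' * s) T l"
    using redundant_colouring_exists[OF assms(2) k(1)] .
  from this(2)[unfolded choice_iff'] obtain T' and l' :: "real \<Rightarrow> nat \<Rightarrow> 'b \<Rightarrow> 'b set set"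
    where col': "\<And>s. s > 0 \<Longrightarrow> redundant_colouring X' m k s (c' * s) (T' s) (l' s)"
    by blast
  note cover = covering_of_redundant_colourings[OF col col' k(2)]
  show ?thesis
  proof (rule nagata_property_any_index)
    show "c + c' > 0"
      using c c' by simp
    fix s :: real
    assume s: "s > 0"
    show "covering_family (prod_metric X X') ({..<k} \<times> UNIV) (\<lambda>(j, a, a').
        {x \<in> T s j. l s j x = a} \<times> {x' \<in> T' s j. l' s j x' = a'})"
      by (rule cover(1)[OF s s])
    show "bounded_family (prod_metric X X') ((c + c') * s) ({..<k} \<times> UNIV) (\<lambda>(j, a, a').
        {x \<in> T s j. l s j x = a} \<times> {x' \<in> T' s j. l' s j x' = a'})"
      using cover(2)[OF s s] by (simp add: distrib_right)
    show "s_multiplicity (prod_metric X X') s ({..<k} \<times> UNIV) (\<lambda>(j, a, a').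
        {x \<in> T s j. l s j x = a} \<times> {x' \<in> T' s j. l' s j x' = a'})
        \<le> ereal (real_of_int (int (n + m) + 1))"
      using cover(3)[OF s s] by (simp add: k_def add.commute)
  qed
qed

text \<open>On a non-empty space the admissible integers are bounded below by \<open>0\<close>, so a finite dimension is
  itself admissible.\<close>

lemma nagata_dim_cases:
  assumes "mspace X \<noteq> {}"
  obtains "nagata_dim X = \<infinity>"
  | n where "nagata_property X (int n)" and "nagata_dim X = ereal (real n)"
proof (cases "\<exists>n. nagata_property X n")
  case False
  then have "nagata_dim X = \<infinity>"
    by (simp add: nagata_dim_def top_ereal_def)
  then show thesis
    by (rule that(1))
next
  case True
  then obtain n where n: "nagata_property X n" ..
  define p where "p = (LEAST p. nagata_property X (int p))"
  have "nagata_property X (int (nat n))"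
    using n nagata_property_nonneg[OF n assms] by simp
  then have p: "nagata_property X (int p)"
    unfolding p_def by (rule LeastI)
  have "ereal (real p) \<le> ereal (real_of_int q)" if q: "nagata_property X q" for q
  proof -
    have "q = int (nat q)"
      using nagata_property_nonneg[OF q assms] by simp
    then have "p \<le> nat q"
      unfolding p_def using q by (intro Least_le) metis
    then show ?thesis
      using \<open>q = int (nat q)\<close> by (simp add: le_nat_iff)
  qed
  then have "nagata_dim X = ereal (real p)"
    unfolding nagata_dim_def
    using p by (intro antisym Inf_lower Inf_greatest) (auto intro: exI[of _ "int p"])
  with p show thesis
    by (rule that(2))
qed

theorem theorem2p6:
  fixes X :: "'a metric" and X' :: "'b metric"
  assumes "mspace X \<noteq> {}" and "mspace X' \<noteq> {}"
  shows "nagata_dim (prod_metric X X') \<le> nagata_dim X + nagata_dim X'"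
proof (cases rule: nagata_dim_cases[OF assms(1)])
  case 1
  then show ?thesis
    by simp
next
  case n: (2 n)
  show ?thesis
  proof (cases rule: nagata_dim_cases[OF assms(2)])
    case 1
    then show ?thesis
      by simp
  next
    case m: (2 m)
    have "nagata_dim (prod_metric X X') \<le> ereal (real_of_int (int (n + m)))"
      unfolding nagata_dim_def using nagata_property_prod[OF n(1) m(1)]
      by (intro Inf_lower) blast
    then show ?thesis
      using n(2) m(2) by simp
  qed
qed

end
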